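(* Let $\alpha\in\mathbb{R}$, $\theta>0$, $\rho>0$, and let $X$ be a random variable distributed as $FTG(\alpha,\theta,\rho)$. Then: (a) For every $\lambda>0$, the random variable $\lambda X$ is distributed as $FTG(\alpha,\theta/\lambda,\rho)$. (b) For every threshold $u>0$, the threshold exceedances $X_u$ are distributed as $FTG(\alpha,\theta,\rho+\theta u)$.
   Context: For $\alpha\in\mathbb{R}$ and $\rho>0$, the (upper) incomplete gamma function is $\Gamma(\alpha,\rho)=\int_\rho^\infty t^{\alpha-1}e^{-t}\,dt$. The full-tails gamma distribution $FTG(\alpha,\theta,\rho)$, with parameters $\alpha\in\mathbb{R}$, $\theta>0$, $\rho>0$, is the continuous probability distribution on $(0,\infty)$ with density $$f(x;\alpha,\theta,\rho)=\frac{\theta(\rho+\theta x)^{\alpha-1}\exp(-(\rho+\theta x))}{\Gamma(\alpha,\rho)},\qquad x>0.$$ Threshold exceedances: if $X$ is a non-negative random variable with absolutely continuous cumulative distribution function $F$ and density $f=F'$, then for $u>0$ the exceedances $X_u$ of $X$ at $u$ have, by definition, the probability density function $$f_u(x)=\frac{f(x+u)}{1-F(u)},\qquad x>0,$$ i.e. $X_u$ has the conditional distribution of $X-u$ given $X>u$. *)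

theory Defs
  imports "HOL-Probability.Probability"
begin

definition upper_Gamma :: "real \<Rightarrow> real \<Rightarrow> real" where
  "upper_Gamma \<alpha> \<rho> = (LBINT t:{\<rho><..}. t powr (\<alpha> - 1) * exp (- t))"

definition ftg_density :: "real \<Rightarrow> real \<Rightarrow> real \<Rightarrow> real \<Rightarrow> real" where
  "ftg_density \<alpha> \<theta> \<rho> x =
     (if 0 < x
      then \<theta> * (\<rho> + \<theta> * x) powr (\<alpha> - 1) * exp (- (\<rho> + \<theta> * x)) / upper_Gamma \<alpha> \<rho>
      else 0)"

definition ftg_distributed :: "'a measure \<Rightarrow> ('a \<Rightarrow> real) \<Rightarrow> real \<Rightarrow> real \<Rightarrow> real \<Rightarrow> bool" where
  "ftg_distributed M X \<alpha> \<theta> \<rho> \<longleftrightarrow>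
     distributed M lborel X (\<lambda>x. ennreal (ftg_density \<alpha> \<theta> \<rho> x))"

definition exceedance_density :: "(real \<Rightarrow> real) \<Rightarrow> (real \<Rightarrow> real) \<Rightarrow> real \<Rightarrow> real \<Rightarrow> real" where
  "exceedance_density f F u x = (if 0 < x then f (x + u) / (1 - F u) else 0)"

(* The exceedances of X at u are determined only in law, so Y may live on a
   different probability space N than X. The density f of X is determined only
   almost everywhere; any nonnegative version is admitted. *)
definition threshold_exceedances ::
  "'a measure \<Rightarrow> ('a \<Rightarrow> real) \<Rightarrow> real \<Rightarrow> 'b measure \<Rightarrow> ('b \<Rightarrow> real) \<Rightarrow> bool" where
  "threshold_exceedances M X u N Y \<longleftrightarrow>
     (\<exists>f. (\<forall>x. 0 \<le> f x) \<and> distributed M lborel X (\<lambda>x. ennreal (f x)) \<and>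
          distributed N lborel Y
            (\<lambda>x. ennreal (exceedance_density f (cdf (distr M borel X)) u x)))"

(* The probability measure M( . | X > u); under it, X - u has the conditional
   distribution of X - u given X > u. *)
definition conditioned_above :: "'a measure \<Rightarrow> ('a \<Rightarrow> real) \<Rightarrow> real \<Rightarrow> 'a measure" where
  "conditioned_above M X u = uniform_measure M {\<omega> \<in> space M. u < X \<omega>}"

end

theory Submission
  imports Defs
begin

text \<open>
  Write \<open>g t = t powr (\<alpha> - 1) * exp (- t)\<close> and \<open>\<Gamma>(\<rho>)\<close> for the integral of \<open>g\<close> over \<open>(\<rho>, \<infinity>)\<close>.
  The density of \<open>FTG(\<alpha>, \<theta>, \<rho>)\<close> at \<open>x > 0\<close> is \<open>\<theta> * g (\<rho> + \<theta> * x) / \<Gamma>(\<rho>)\<close>, so \<open>\<rho> + \<theta> * X\<close> has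
  the law of density proportional to \<open>g\<close>, truncated to \<open>(\<rho>, \<infinity>)\<close>. Scaling \<open>X\<close> by \<open>l\<close> and dividing
  \<open>\<theta>\<close> by \<open>l\<close> leaves \<open>\<rho> + \<theta> * X\<close> unchanged, which is part (a). Conditioning on \<open>X > u\<close> raises the
  truncation point to \<open>\<rho> + \<theta> * u\<close>, and \<open>\<rho> + \<theta> * X = (\<rho> + \<theta> * u) + \<theta> * (X - u)\<close>, which is part (b).

  In terms of densities, part (b) is the tail formula \<open>P(X > u) = \<Gamma>(\<rho> + \<theta> * u) / \<Gamma>(\<rho>)\<close>
  (\<open>ftg_distributed_tail\<close>): dividing the shifted density by this number exchanges the normalising
  constant \<open>\<Gamma>(\<rho>)\<close> for \<open>\<Gamma>(\<rho> + \<theta> * u)\<close> (\<open>exceedance_density_ftg\<close>). Since a density of \<open>X\<close> is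
  determined only almost everywhere, the equality of densities is transported along null sets
  (\<open>ftg_distributed_if_threshold_exceedances\<close>). That \<open>X - u\<close> under \<open>P( . | X > u)\<close> has the
  exceedance density is a general fact about random variables with a density
  (\<open>threshold_exceedances_conditioned_above\<close>).

  All divisions require \<open>\<Gamma>(\<rho>) > 0\<close>, that is, integrability of \<open>g\<close> on \<open>(\<rho>, \<infinity>)\<close>. No growth estimate is
  made: if the integral were zero or divergent, \<open>upper_Gamma\<close> would be \<open>0\<close> and with it the density
  of \<open>X\<close>, which has total mass one.
\<close>

section \<open>Positivity of the incomplete gamma function\<close>

lemma upper_Gamma_nonneg: "0 \<le> upper_Gamma \<alpha> \<rho>"
  unfolding upper_Gamma_def set_lebesgue_integral_def
  by (intro Bochner_Integration.integral_nonneg) (simp add: indicator_def)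

lemma ftg_density_nonneg: "0 < \<theta> \<Longrightarrow> 0 \<le> ftg_density \<alpha> \<theta> \<rho> x"
  using upper_Gamma_nonneg[of \<alpha> \<rho>] by (simp add: ftg_density_def)

lemma borel_measurable_ftg_density [measurable]: "ftg_density \<alpha> \<theta> \<rho> \<in> borel_measurable borel"
  unfolding ftg_density_def by measurable

text \<open>A non-integrable function has Bochner integral \<open>0\<close>, so a nonzero value certifies
  integrability.\<close>

lemma set_integrable_if_upper_Gamma_nonzero:
  assumes "upper_Gamma \<alpha> \<rho> \<noteq> 0"
  shows "set_integrable lborel {\<rho><..} (\<lambda>t. t powr (\<alpha> - 1) * exp (- t))"
  using assms not_integrable_integral_eq
  unfolding upper_Gamma_def set_integrable_def set_lebesgue_integral_def by blast

lemma nn_integral_upper_Gamma: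
  assumes "upper_Gamma \<alpha> \<rho> \<noteq> 0" "\<rho> \<le> \<sigma>"
  shows "(\<integral>\<^sup>+t. ennreal (t powr (\<alpha> - 1) * exp (- t)) * indicator {\<sigma><..} t \<partial>lborel)
    = ennreal (upper_Gamma \<alpha> \<sigma>)"
proof -
  let ?g = "\<lambda>t::real. t powr (\<alpha> - 1) * exp (- t)"
  have int: "set_integrable lborel {\<sigma><..} ?g"
    using set_integrable_if_upper_Gamma_nonzero[OF assms(1)]
    by (rule set_integrable_subset) (use assms(2) in auto)
  have "(\<integral>\<^sup>+t. ennreal (?g t) * indicator {\<sigma><..} t \<partial>lborel)
      = (\<integral>\<^sup>+t. ennreal (indicator {\<sigma><..} t *\<^sub>R ?g t) \<partial>lborel)"
    by (intro nn_integral_cong) (simp split: split_indicator)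
  also have "\<dots> = ennreal (upper_Gamma \<alpha> \<sigma>)"
    unfolding upper_Gamma_def set_lebesgue_integral_def
    by (rule nn_integral_eq_integral)
       (use int in \<open>auto simp: set_integrable_def split: split_indicator\<close>)
  finally show ?thesis .
qed

text \<open>Integrability on \<open>(\<rho>, \<infinity>)\<close> passes to \<open>(\<sigma>, \<infinity>)\<close>, where the integrand is positive on a set of
  infinite measure. The tail formula needs this at \<open>\<sigma> = \<rho> + \<theta> * u\<close>, so that the event \<open>X > u\<close> can be
  conditioned on.\<close>

lemma upper_Gamma_pos_above:
  assumes "upper_Gamma \<alpha> \<rho> \<noteq> 0" "0 < \<rho>" "\<rho> \<le> \<sigma>"
  shows "0 < upper_Gamma \<alpha> \<sigma>"
proof (rule ccontr)
  let ?h = "\<lambda>t. ennreal (t powr (\<alpha> - 1) * exp (- t)) * indicator {\<sigma><..} t"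
  assume "\<not> 0 < upper_Gamma \<alpha> \<sigma>"
  then have "(\<integral>\<^sup>+t. ?h t \<partial>lborel) = 0"
    using nn_integral_upper_Gamma[OF assms(1,3)] upper_Gamma_nonneg[of \<alpha> \<sigma>] by simp
  then have "AE t in lborel. ?h t = 0"
    by (subst (asm) nn_integral_0_iff_AE) auto
  then have "AE t in lborel. t \<notin> {\<sigma><..}"
    by eventually_elim (use assms in \<open>auto split: split_indicator_asm\<close>)
  then have "emeasure lborel {\<sigma><..} = 0"
    by (subst (asm) AE_iff_measurable[OF _ refl]) (auto simp: greaterThan_def)
  \<comment> \<open>A unit interval inside the half-line already has measure one.\<close>
  then have "emeasure lborel {\<sigma><..<\<sigma> + 1} = 0"
    by (rule emeasure_eq_0[rotated]) auto
  then show False by simp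
qed

section \<open>Tail and exceedances of the FTG distribution\<close>

context prob_space
begin

lemma upper_Gamma_nonzero_if_ftg_distributed:
  assumes "ftg_distributed M X \<alpha> \<theta> \<rho>"
  shows "upper_Gamma \<alpha> \<rho> \<noteq> 0"
proof
  assume "upper_Gamma \<alpha> \<rho> = 0"
  then have "distributed M lborel X (\<lambda>x. 0)"
    using assms by (simp add: ftg_distributed_def ftg_density_def cong: if_cong)
  from distributed_imp_emeasure_nonzero[OF this] show False by simp
qed

text \<open>The substitution \<open>t = \<rho> + \<theta> * x\<close> maps \<open>(u, \<infinity>)\<close> onto \<open>(\<rho> + \<theta> * u, \<infinity>)\<close> and turns the density into
  the integrand of the incomplete gamma function.\<close>

lemma ftg_distributed_tail:
  assumes X: "ftg_distributed M X \<alpha> \<theta> \<rho>" and "0 < \<theta>" "0 < \<rho>" "0 \<le> u"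
  shows "prob {\<omega> \<in> space M. u < X \<omega>} = upper_Gamma \<alpha> (\<rho> + \<theta> * u) / upper_Gamma \<alpha> \<rho>"
proof -
  let ?g = "\<lambda>t::real. t powr (\<alpha> - 1) * exp (- t)" and ?\<sigma> = "\<rho> + \<theta> * u"
  let ?h = "\<lambda>t. ennreal (?g t) * indicator {?\<sigma><..} t"
  have nz: "upper_Gamma \<alpha> \<rho> \<noteq> 0"
    by (rule upper_Gamma_nonzero_if_ftg_distributed[OF X])
  have pos: "0 < upper_Gamma \<alpha> \<rho>"
    using upper_Gamma_pos_above[OF nz \<open>0 < \<rho>\<close>] by simp
  have X': "distributed M lborel X (\<lambda>x. ennreal (ftg_density \<alpha> \<theta> \<rho> x))"
    using X by (simp add: ftg_distributed_def)
  have "emeasure M {\<omega> \<in> space M. u < X \<omega>} = emeasure M (X -` {u<..} \<inter> space M)"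
    by (rule arg_cong[where f = "emeasure M"]) auto
  also have "\<dots> = (\<integral>\<^sup>+x. ennreal (ftg_density \<alpha> \<theta> \<rho> x) * indicator {u<..} x \<partial>lborel)"
    by (rule distributed_emeasure[OF X']) simp
  also have "\<dots> = (\<integral>\<^sup>+x. ennreal (\<theta> / upper_Gamma \<alpha> \<rho>) * ?h (\<rho> + \<theta> * x) \<partial>lborel)"
    using assms pos
    by (intro nn_integral_cong)
       (auto simp: ftg_density_def ennreal_mult'[symmetric] mult.assoc split: split_indicator)
  also have "\<dots> = ennreal (1 / upper_Gamma \<alpha> \<rho>) * (ennreal \<bar>\<theta>\<bar> * (\<integral>\<^sup>+x. ?h (\<rho> + \<theta> * x) \<partial>lborel))"
    using \<open>0 < \<theta>\<close> pos
    by (subst nn_integral_cmult) (simp_all add: mult.assoc[symmetric] ennreal_mult'[symmetric])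
  also have "ennreal \<bar>\<theta>\<bar> * (\<integral>\<^sup>+x. ?h (\<rho> + \<theta> * x) \<partial>lborel) = (\<integral>\<^sup>+t. ?h t \<partial>lborel)"
    using \<open>0 < \<theta>\<close> by (intro nn_integral_real_affine[symmetric]) auto
  also have "\<dots> = ennreal (upper_Gamma \<alpha> ?\<sigma>)"
    using assms by (intro nn_integral_upper_Gamma[OF nz]) simp
  finally have "emeasure M {\<omega> \<in> space M. u < X \<omega>}
      = ennreal (upper_Gamma \<alpha> ?\<sigma> / upper_Gamma \<alpha> \<rho>)"
    using pos upper_Gamma_nonneg[of \<alpha> ?\<sigma>] by (simp add: ennreal_mult'[symmetric])
  then show ?thesis
    using pos upper_Gamma_nonneg[of \<alpha> ?\<sigma>] by (simp add: measure_def)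
qed

lemma cdf_distr_tail:
  assumes "X \<in> borel_measurable M"
  shows "1 - cdf (distr M borel X) u = prob {\<omega> \<in> space M. u < X \<omega>}"
proof -
  have "cdf (distr M borel X) u = prob {\<omega> \<in> space M. X \<omega> \<le> u}"
    using assms by (auto simp: cdf_def measure_distr intro!: arg_cong[where f = prob])
  also have "1 - \<dots> = prob {\<omega> \<in> space M. \<not> X \<omega> \<le> u}"
    using assms by (intro prob_neg[symmetric]) measurable
  finally show ?thesis by (simp add: not_le)
qed

lemma exceedance_density_ftg:
  assumes X: "ftg_distributed M X \<alpha> \<theta> \<rho>" and "0 < \<theta>" "0 < \<rho>" "0 \<le> u"
  shows "exceedance_density (ftg_density \<alpha> \<theta> \<rho>) (cdf (distr M borel X)) u x
    = ftg_density \<alpha> \<theta> (\<rho> + \<theta> * u) x"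
proof -
  have "X \<in> borel_measurable M"
    using X distributed_measurable unfolding ftg_distributed_def by fastforce
  then have tail: "1 - cdf (distr M borel X) u = upper_Gamma \<alpha> (\<rho> + \<theta> * u) / upper_Gamma \<alpha> \<rho>"
    using ftg_distributed_tail[OF assms] cdf_distr_tail by simp
  have "upper_Gamma \<alpha> \<rho> \<noteq> 0"
    by (rule upper_Gamma_nonzero_if_ftg_distributed[OF X])
  then show ?thesis
    using \<open>0 \<le> u\<close> unfolding exceedance_density_def tail ftg_density_def
    by (simp add: algebra_simps)
qed

text \<open>Any two densities of \<open>X\<close> agree almost everywhere, hence so do their translates by \<open>u\<close>; the
  exceedance density computed from an arbitrary version is therefore a version of the one
  computed from \<open>ftg_density\<close>.\<close>

lemma ftg_distributed_if_threshold_exceedances: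
  assumes X: "ftg_distributed M X \<alpha> \<theta> \<rho>" and pos: "0 < \<theta>" "0 < \<rho>" "0 \<le> u"
    and Y: "threshold_exceedances M X u N Y"
  shows "ftg_distributed N Y \<alpha> \<theta> (\<rho> + \<theta> * u)"
proof -
  let ?F = "cdf (distr M borel X)"
  obtain f where f: "\<And>x. 0 \<le> f x"
    and fX: "distributed M lborel X (\<lambda>x. ennreal (f x))"
    and fY: "distributed N lborel Y (\<lambda>x. ennreal (exceedance_density f ?F u x))"
    using Y unfolding threshold_exceedances_def by blast
  have [measurable]: "f \<in> borel_measurable borel"
    using distributed_real_measurable[OF _ fX] f by simp
  have "AE x in lborel. ennreal (f x) = ennreal (ftg_density \<alpha> \<theta> \<rho> x)"
    using distributed_unique[OF fX] X unfolding ftg_distributed_def by blast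
  then have "AE x in lborel. f x = ftg_density \<alpha> \<theta> \<rho> x"
    using f ftg_density_nonneg[OF \<open>0 < \<theta>\<close>] by (simp add: ennreal_inj)
  then have "AE x in lborel. f (u + 1 * x) = ftg_density \<alpha> \<theta> \<rho> (u + 1 * x)"
    by (intro AE_borel_affine) auto
  then have ae: "AE x in lborel. ennreal (exceedance_density f ?F u x)
      = ennreal (ftg_density \<alpha> \<theta> (\<rho> + \<theta> * u) x)"
  proof eventually_elim
    case (elim x)
    then have "exceedance_density f ?F u x = exceedance_density (ftg_density \<alpha> \<theta> \<rho>) ?F u x"
      by (simp add: exceedance_density_def add.commute)
    then show ?case by (simp add: exceedance_density_ftg[OF X pos])
  qed
  show ?thesis
    unfolding ftg_distributed_def
    using fY by (rule distributed_cong_density[THEN iffD1, OF ae, rotated 2])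
       (use distributed_borel_measurable[OF fY] in simp_all)
qed

end

section \<open>Conditional laws as exceedances\<close>

text \<open>The density of \<open>P( . | X \<in> B)\<close> with respect to \<open>P\<close> is a function of \<open>X\<close>, so it multiplies the
  density of \<open>X\<close>.\<close>

lemma distributed_uniform_measure_vimage:
  assumes X: "distributed M N X f" and B: "B \<in> sets N"
  defines "A \<equiv> {\<omega> \<in> space M. X \<omega> \<in> B}"
  shows "distributed (uniform_measure M A) N X (\<lambda>x. f x * (indicator B x / emeasure M A))"
proof -
  let ?w = "\<lambda>x. indicator B x / emeasure M A"
  have [measurable]: "X \<in> measurable M N" "f \<in> borel_measurable N" "B \<in> sets N"
    using distributed_measurable[OF X] distributed_borel_measurable[OF X] B by auto
  have [measurable]: "A \<in> sets M"
    unfolding A_def by measurable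
  have "uniform_measure M A = density M (\<lambda>\<omega>. ?w (X \<omega>))"
    unfolding uniform_measure_def
    by (intro density_cong) (auto simp: A_def split: split_indicator)
  then have "distr (uniform_measure M A) N X = density (distr M N X) ?w"
    by (simp add: density_distr)
  also have "\<dots> = density N (\<lambda>x. f x * ?w x)"
    using X by (simp add: distributed_distr_eq_density density_density_eq)
  finally show ?thesis
    unfolding distributed_def by (simp add: uniform_measure_def)
qed

text \<open>The event \<open>X > u\<close> is \<open>X - u > 0\<close>, so the previous lemma applies to the translated variable
  \<open>X - u\<close> and \<open>B = (0, \<infinity>)\<close>. A positive tail probability is required because division by zero gives
  \<open>0\<close> in the reals but not in the extended nonnegative reals.\<close>

lemma (in prob_space) threshold_exceedances_conditioned_above:
  fixes f :: "real \<Rightarrow> real"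
  assumes f: "\<And>x. 0 \<le> f x" and X: "distributed M lborel X (\<lambda>x. ennreal (f x))"
    and tail: "0 < prob {\<omega> \<in> space M. u < X \<omega>}"
  shows "threshold_exceedances M X u (conditioned_above M X u) (\<lambda>\<omega>. X \<omega> - u)"
proof -
  let ?A = "{\<omega> \<in> space M. u < X \<omega>}"
  have A: "{\<omega> \<in> space M. - u + 1 * X \<omega> \<in> {0<..}} = ?A" by auto
  have cdf: "1 - cdf (distr M borel X) u = prob ?A"
    using distributed_measurable[OF X] by (intro cdf_distr_tail) simp
  have "distributed M lborel (\<lambda>\<omega>. - u + 1 * X \<omega>) (\<lambda>x. ennreal (f ((x - - u) / 1)) / ennreal \<bar>1\<bar>)"
    by (rule distributed_affine[OF X]) simp
  from distributed_uniform_measure_vimage[OF this, of "{0<..}"]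
  have "distributed (uniform_measure M ?A) lborel (\<lambda>\<omega>. X \<omega> - u)
      (\<lambda>x. ennreal (f (x + u)) * (indicator {0<..} x / emeasure M ?A))"
    using f divide_ennreal[of _ 1] unfolding A by simp
  also have "(\<lambda>x. ennreal (f (x + u)) * (indicator {0<..} x / emeasure M ?A))
      = (\<lambda>x. ennreal (exceedance_density f (cdf (distr M borel X)) u x))"
    using f tail
    by (auto simp: exceedance_density_def cdf emeasure_eq_measure ennreal_times_divide divide_ennreal
        split: split_indicator)
  finally show ?thesis
    using f X unfolding threshold_exceedances_def conditioned_above_def by blast
qed

section \<open>Scaling and the two closure properties\<close>

lemma (in prob_space) ftg_distributed_scale:
  assumes X: "ftg_distributed M X \<alpha> \<theta> \<rho>" and "0 < l"
  shows "ftg_distributed M (\<lambda>\<omega>. l * X \<omega>) \<alpha> (\<theta> / l) \<rho>"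
proof -
  have "distributed M lborel (\<lambda>\<omega>. 0 + l * X \<omega>)
      (\<lambda>x. ennreal (ftg_density \<alpha> \<theta> \<rho> ((x - 0) / l)) / ennreal \<bar>l\<bar>)"
    using X \<open>0 < l\<close> unfolding ftg_distributed_def by (intro distributed_affine) auto
  also have "(\<lambda>x. ennreal (ftg_density \<alpha> \<theta> \<rho> ((x - 0) / l)) / ennreal \<bar>l\<bar>)
      = (\<lambda>x. ennreal (ftg_density \<alpha> (\<theta> / l) \<rho> x))"
  proof
    fix x
    have "ftg_density \<alpha> \<theta> \<rho> (x / l) / l = ftg_density \<alpha> (\<theta> / l) \<rho> x"
      using \<open>0 < l\<close> by (simp add: ftg_density_def zero_less_divide_iff)
    then show "ennreal (ftg_density \<alpha> \<theta> \<rho> ((x - 0) / l)) / ennreal \<bar>l\<bar>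
        = ennreal (ftg_density \<alpha> (\<theta> / l) \<rho> x)"
      using \<open>0 < l\<close> by (simp add: divide_ennreal_def inverse_ennreal ennreal_mult''[symmetric]
          divide_inverse[symmetric] del: times_divide_eq_left)
  qed
  finally show ?thesis by (simp add: ftg_distributed_def)
qed

theorem proposition2:
  fixes M :: "'a measure" and X :: "'a \<Rightarrow> real" and \<alpha> \<theta> \<rho> :: real
  assumes "prob_space M"
    and "0 < \<theta>" and "0 < \<rho>"
    and "ftg_distributed M X \<alpha> \<theta> \<rho>"
  shows "(\<forall>l>0. ftg_distributed M (\<lambda>\<omega>. l * X \<omega>) \<alpha> (\<theta> / l) \<rho>) \<and>
    (\<forall>u>0.
       (\<forall>(N :: 'b measure) Y. prob_space N \<longrightarrow> threshold_exceedances M X u N Y \<longrightarrow>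
          ftg_distributed N Y \<alpha> \<theta> (\<rho> + \<theta> * u)) \<and>
       threshold_exceedances M X u (conditioned_above M X u) (\<lambda>\<omega>. X \<omega> - u) \<and>
       ftg_distributed (conditioned_above M X u) (\<lambda>\<omega>. X \<omega> - u) \<alpha> \<theta> (\<rho> + \<theta> * u))"
proof -
  interpret prob_space M by fact
  note X = \<open>ftg_distributed M X \<alpha> \<theta> \<rho>\<close> and pos = \<open>0 < \<theta>\<close> \<open>0 < \<rho>\<close>
  have exceed: "threshold_exceedances M X u (conditioned_above M X u) (\<lambda>\<omega>. X \<omega> - u)"
    if "0 < u" for u
  proof (rule threshold_exceedances_conditioned_above)
    show "0 \<le> ftg_density \<alpha> \<theta> \<rho> x" for x
      by (rule ftg_density_nonneg[OF \<open>0 < \<theta>\<close>])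
    show "distributed M lborel X (\<lambda>x. ennreal (ftg_density \<alpha> \<theta> \<rho> x))"
      using X by (simp add: ftg_distributed_def)
    have "0 < upper_Gamma \<alpha> \<sigma>" if "\<rho> \<le> \<sigma>" for \<sigma>
      by (rule upper_Gamma_pos_above[OF upper_Gamma_nonzero_if_ftg_distributed[OF X] \<open>0 < \<rho>\<close> that])
    then show "0 < prob {\<omega> \<in> space M. u < X \<omega>}"
      using ftg_distributed_tail[OF X pos, of u] pos \<open>0 < u\<close> by simp
  qed
  show ?thesis
  proof (intro conjI allI impI)
    show "ftg_distributed M (\<lambda>\<omega>. l * X \<omega>) \<alpha> (\<theta> / l) \<rho>" if "0 < l" for l
      by (rule ftg_distributed_scale[OF X that])
  next
    fix u :: real and N :: "'b measure" and Y
    assume "0 < u" "threshold_exceedances M X u N Y"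
    then show "ftg_distributed N Y \<alpha> \<theta> (\<rho> + \<theta> * u)"
      by (intro ftg_distributed_if_threshold_exceedances[OF X pos]) simp_all
  next
    fix u :: real
    assume "0 < u"
    show "threshold_exceedances M X u (conditioned_above M X u) (\<lambda>\<omega>. X \<omega> - u)"
      by (rule exceed[OF \<open>0 < u\<close>])
    then show "ftg_distributed (conditioned_above M X u) (\<lambda>\<omega>. X \<omega> - u) \<alpha> \<theta> (\<rho> + \<theta> * u)"
      using \<open>0 < u\<close> by (intro ftg_distributed_if_threshold_exceedances[OF X pos]) simp_all
  qed
qed

end
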